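(* Let $\mathbb{P}$ be a forcing notion, $\mathscr{B}$ a Boolean algebra, and $\iota \colon \mathbb{P} \to \mathscr{B}^{+}$ a complete embedding. If $n \in \omega \setminus \{0\}$ and $\bar{q} = \langle q_i \colon i < n\rangle \in {}^{n}\mathbb{P}$, then $$i_{\ast}^{\mathbb{P}}(\bar{q}) = \max\left\{ |I| \colon I \subseteq n \text{ and } \bigwedge_{i \in I} \iota(q_i) \neq 0_{\mathscr{B}} \right\}.$$
   Context: A forcing notion is a nonempty preordered set $(\mathbb{P}, \leq)$; $p, q \in \mathbb{P}$ are compatible if they have a common lower bound in $\mathbb{P}$, incompatible otherwise. For a Boolean algebra $\mathscr{B}$, $\mathscr{B}^{+} = \mathscr{B} \setminus \{0_{\mathscr{B}}\}$, regarded as a forcing notion with the order of $\mathscr{B}$. A complete embedding $\iota \colon \mathbb{P} \to \mathbb{Q}$ between forcing notions is a map that preserves $\leq$, preserves incompatibility, and is such that every $q \in \mathbb{Q}$ has a reduction $r \in \mathbb{P}$, i.e. $\iota(r')$ is compatible with $q$ for every $r' \leq r$ in $\mathbb{P}$ (equivalently, it preserves order, incompatibility and maximal antichains). For a finite sequence $\bar{q} = \langle q_i \colon i < n\rangle \in {}^{n}\mathbb{P}$ (a function from $n=\{0,\dots,n-1\}$ to $\mathbb{P}$), $$i_{\ast}^{\mathbb{P}}(\bar{q}) := \max\{ |F| \colon F \subseteq n \text{ and } \{q_i \colon i \in F\} \text{ has a lower bound in } \mathbb{P}\}.$$ *)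

theory Defs
  imports Main
begin

text \<open>An order is given as a relation \<open>r\<close> on its carrier; \<open>(p, q) \<in> r\<close> means \<open>p \<le> q\<close>.\<close>

definition forcing_notion :: "'a set \<Rightarrow> ('a \<times> 'a) set \<Rightarrow> bool"
  where "forcing_notion P r \<longleftrightarrow> P \<noteq> {} \<and> preorder_on P r"

definition has_lower_bound :: "'a set \<Rightarrow> ('a \<times> 'a) set \<Rightarrow> 'a set \<Rightarrow> bool"
  where "has_lower_bound P r A \<longleftrightarrow> (\<exists>p\<in>P. \<forall>a\<in>A. (p, a) \<in> r)"

definition compatible :: "'a set \<Rightarrow> ('a \<times> 'a) set \<Rightarrow> 'a \<Rightarrow> 'a \<Rightarrow> bool"
  where "compatible P r p q \<longleftrightarrow> has_lower_bound P r {p, q}"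

definition is_reduction ::
  "'a set \<Rightarrow> ('a \<times> 'a) set \<Rightarrow> 'b set \<Rightarrow> ('b \<times> 'b) set \<Rightarrow> ('a \<Rightarrow> 'b) \<Rightarrow> 'b \<Rightarrow> 'a \<Rightarrow> bool"
  where "is_reduction P r Q s \<iota> q p \<longleftrightarrow>
    p \<in> P \<and> (\<forall>p'\<in>P. (p', p) \<in> r \<longrightarrow> compatible Q s (\<iota> p') q)"

definition complete_embedding ::
  "'a set \<Rightarrow> ('a \<times> 'a) set \<Rightarrow> 'b set \<Rightarrow> ('b \<times> 'b) set \<Rightarrow> ('a \<Rightarrow> 'b) \<Rightarrow> bool"
  where "complete_embedding P r Q s \<iota> \<longleftrightarrow>
    (\<forall>p\<in>P. \<iota> p \<in> Q) \<and>
    (\<forall>p\<in>P. \<forall>p'\<in>P. (p, p') \<in> r \<longrightarrow> (\<iota> p, \<iota> p') \<in> s) \<and>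
    (\<forall>p\<in>P. \<forall>p'\<in>P. \<not> compatible P r p p' \<longrightarrow> \<not> compatible Q s (\<iota> p) (\<iota> p')) \<and>
    (\<forall>q\<in>Q. \<exists>p. is_reduction P r Q s \<iota> q p)"

definition positives :: "'b::boolean_algebra set"
  where "positives = UNIV - {bot}"

definition positives_le :: "('b::boolean_algebra \<times> 'b) set"
  where "positives_le = {(a, b). a \<in> positives \<and> b \<in> positives \<and> a \<le> b}"

text \<open>The sequence \<open>q\<close> of length \<open>n\<close> is represented by a function on \<open>nat\<close>, of which
  only the values at \<open>i < n\<close> are used.\<close>

definition i_star :: "'a set \<Rightarrow> ('a \<times> 'a) set \<Rightarrow> nat \<Rightarrow> (nat \<Rightarrow> 'a) \<Rightarrow> nat"
  where "i_star P r n q = Max {card F | F. F \<subseteq> {..<n} \<and> has_lower_bound P r (q ` F)}"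

text \<open>A Boolean algebra need not be complete, so only meets of finite families are formed;
  the empty meet is \<open>top\<close>.\<close>

definition finite_meet :: "('i \<Rightarrow> 'b::boolean_algebra) \<Rightarrow> 'i set \<Rightarrow> 'b"
  where "finite_meet f I = comm_monoid_set.F inf top f I"

lemma
  fixes f :: "'i \<Rightarrow> 'b::boolean_algebra"
  shows finite_meet_empty: "finite_meet f {} = top"
    and finite_meet_insert:
    "finite I \<Longrightarrow> i \<notin> I \<Longrightarrow> finite_meet f (insert i I) = inf (f i) (finite_meet f I)"
proof -
  interpret comm_monoid_set "inf :: 'b \<Rightarrow> 'b \<Rightarrow> 'b" top
    by (rule comm_monoid_set.intro) (rule inf_top.comm_monoid_axioms)
  show "finite_meet f {} = top"
    by (simp add: finite_meet_def)
  show "finite I \<Longrightarrow> i \<notin> I \<Longrightarrow> finite_meet f (insert i I) = inf (f i) (finite_meet f I)"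
    by (simp add: finite_meet_def)
qed

lemma forcing_notion_positives:
  assumes "(bot :: 'b::boolean_algebra) \<noteq> top"
  shows "forcing_notion (positives :: 'b set) positives_le"
proof -
  have "(top :: 'b) \<in> positives"
    using assms by (auto simp: positives_def)
  then show ?thesis
    by (auto simp: forcing_notion_def preorder_on_def positives_le_def refl_on_def
        intro!: transI)
qed

end

theory Submission
  imports Defs
begin

text \<open>The two maxima agree because they range over the same index sets. In the positive part of a
  Boolean algebra, a finite family has a lower bound exactly when its meet is nonzero, the meet
  itself being the witness (\<open>has_lower_bound_positives_iff\<close>). So it suffices that a complete
  embedding both preserves and reflects the existence of lower bounds of finite sets
  (\<open>complete_embedding_has_lower_bound_iff\<close>). Preservation is monotonicity. For reflection,
  incompatibility preservation alone gives only the case of two elements: pairwise compatible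
  elements need not have a common lower bound. The reduction makes up for this. If \<open>p\<close> is a
  reduction of a lower bound \<open>b\<close> of the images, then the image of every condition below \<open>p\<close>
  remains compatible with \<open>b\<close>, and so the given elements can be met one after another by
  descending below \<open>p\<close>.\<close>

text \<open>The induction has to keep the witness below the reduction \<open>p\<close>, since only there is
  compatibility with \<open>b\<close> guaranteed for the next step.\<close>

lemma reduction_lower_bound:
  assumes r: "preorder_on P r" and s: "trans s"
    and incompat: "\<And>x y. x \<in> P \<Longrightarrow> y \<in> P \<Longrightarrow> compatible Q s (\<iota> x) (\<iota> y) \<Longrightarrow> compatible P r x y"
    and red: "is_reduction P r Q s \<iota> b p"
    and "finite A" "A \<subseteq> P" "\<And>a. a \<in> A \<Longrightarrow> (b, \<iota> a) \<in> s"
  shows "\<exists>p'\<in>P. (p', p) \<in> r \<and> (\<forall>a\<in>A. (p', a) \<in> r)"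
  using assms(5-)
proof (induction A rule: finite_induct)
  case empty
  have "p \<in> P" using red by (simp add: is_reduction_def)
  then show ?case using r by (auto simp: preorder_on_def refl_on_def)
next
  case (insert a A)
  obtain p' where p': "p' \<in> P" "(p', p) \<in> r" "\<forall>x\<in>A. (p', x) \<in> r"
    using insert.IH insert.prems by auto
  have "compatible Q s (\<iota> p') b"
    using red p' by (simp add: is_reduction_def)
  then have "compatible Q s (\<iota> p') (\<iota> a)"
    using insert.prems(2)[of a] s
    by (auto simp: compatible_def has_lower_bound_def dest: transD)
  then have "compatible P r p' a"
    using incompat p'(1) insert.prems(1) by blast
  then obtain t where "t \<in> P" "(t, p') \<in> r" "(t, a) \<in> r"
    by (auto simp: compatible_def has_lower_bound_def)
  moreover have "trans r" using r by (simp add: preorder_on_def)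
  ultimately show ?case using p' by (auto dest: transD)
qed

lemma complete_embedding_has_lower_bound_iff:
  assumes r: "preorder_on P r" and s: "trans s"
    and \<iota>: "complete_embedding P r Q s \<iota>"
    and A: "finite A" "A \<subseteq> P"
  shows "has_lower_bound P r A \<longleftrightarrow> has_lower_bound Q s (\<iota> ` A)"
proof
  assume "has_lower_bound P r A"
  then show "has_lower_bound Q s (\<iota> ` A)"
    using \<iota> A by (fastforce simp: has_lower_bound_def complete_embedding_def)
next
  assume "has_lower_bound Q s (\<iota> ` A)"
  then obtain b where b: "b \<in> Q" "\<And>a. a \<in> A \<Longrightarrow> (b, \<iota> a) \<in> s"
    by (auto simp: has_lower_bound_def)
  obtain p where p: "is_reduction P r Q s \<iota> b p"
    using \<iota> b(1) by (auto simp: complete_embedding_def)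
  have incompat: "compatible P r x y"
    if "x \<in> P" "y \<in> P" "compatible Q s (\<iota> x) (\<iota> y)" for x y
    using \<iota> that by (auto simp: complete_embedding_def)
  show "has_lower_bound P r A"
    using reduction_lower_bound[OF r s incompat p A b(2)]
    by (auto simp: has_lower_bound_def)
qed

lemma le_finite_meet_iff:
  fixes f :: "'i \<Rightarrow> 'b::boolean_algebra"
  assumes "finite I"
  shows "a \<le> finite_meet f I \<longleftrightarrow> (\<forall>i\<in>I. a \<le> f i)"
  using assms by induction (simp_all add: finite_meet_empty finite_meet_insert)

lemma has_lower_bound_positives_iff:
  fixes f :: "'i \<Rightarrow> 'b::boolean_algebra"
  assumes "finite I" and f: "\<And>i. i \<in> I \<Longrightarrow> f i \<in> positives"
  shows "has_lower_bound positives positives_le (f ` I) \<longleftrightarrow> finite_meet f I \<noteq> bot"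
proof -
  have "has_lower_bound positives positives_le (f ` I) \<longleftrightarrow>
      (\<exists>a\<in>positives. a \<le> finite_meet f I)"
    using f by (auto simp: has_lower_bound_def positives_le_def le_finite_meet_iff[OF assms(1)])
  also have "\<dots> \<longleftrightarrow> finite_meet f I \<noteq> bot"
    by (auto simp: positives_def bot_unique)
  finally show ?thesis .
qed

theorem theorem3p2:
  fixes P :: "'a set" and r :: "('a \<times> 'a) set"
    and \<iota> :: "'a \<Rightarrow> 'b::boolean_algebra"
    and n :: nat and q :: "nat \<Rightarrow> 'a"
  assumes "forcing_notion P r"
    and "complete_embedding P r positives positives_le \<iota>"
    and "n \<noteq> 0"
    and "\<And>i. i < n \<Longrightarrow> q i \<in> P"
  shows "i_star P r n q =
    Max {card I | I. I \<subseteq> {..<n} \<and> finite_meet (\<lambda>i. \<iota> (q i)) I \<noteq> bot}"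
proof -
  have r: "preorder_on P r"
    using assms(1) by (simp add: forcing_notion_def)
  have s: "trans (positives_le :: ('b \<times> 'b) set)"
    by (auto simp: positives_le_def intro!: transI)
  have "has_lower_bound P r (q ` I) \<longleftrightarrow> finite_meet (\<lambda>i. \<iota> (q i)) I \<noteq> bot"
    if I: "I \<subseteq> {..<n}" for I
  proof -
    have fin: "finite I" using I finite_subset by blast
    have qP: "q ` I \<subseteq> P" using I assms(4) by auto
    then have pos: "\<iota> (q i) \<in> positives" if "i \<in> I" for i
      using that assms(2) by (auto simp: complete_embedding_def)
    have "has_lower_bound P r (q ` I) \<longleftrightarrow>
        has_lower_bound positives positives_le ((\<lambda>i. \<iota> (q i)) ` I)"
      using complete_embedding_has_lower_bound_iff[OF r s assms(2) finite_imageI[OF fin] qP]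
      by (simp add: image_image)
    also have "\<dots> \<longleftrightarrow> finite_meet (\<lambda>i. \<iota> (q i)) I \<noteq> bot"
      using has_lower_bound_positives_iff[OF fin, of "\<lambda>i. \<iota> (q i)"] pos by blast
    finally show ?thesis .
  qed
  then show ?thesis
    unfolding i_star_def by (metis (no_types, lifting))
qed

end
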